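(* If $G$ is a connected $P_5$-free chordal bipartite graph, then its complement $\overline{G}$ is a chordal graph.
   Context: Graphs are finite, simple and undirected. A bipartite graph is chordal bipartite if every cycle of length at least six has a chord. $P_5$-free means no induced path on five vertices. The complement $\overline{G}$ has vertex set $V(G)$ and edge set $\{\{u,v\}: u\ne v,\ \{u,v\}\notin E(G)\}$. A graph is chordal if it has no induced cycle of length at least four. *)

theory Defs
  imports Main
begin

record 'a ugraph =
  verts :: "'a set"
  edges :: "'a set set"

definition simple_graph :: "'a ugraph \<Rightarrow> bool" where
  "simple_graph G \<longleftrightarrow>
     finite (verts G) \<and> (\<forall>e\<in>edges G. e \<subseteq> verts G \<and> card e = 2)"

definition graph_complement :: "'a ugraph \<Rightarrow> 'a ugraph" where
  "graph_complement G =
     \<lparr>verts = verts G,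
      edges = {{u, v} |u v. u \<in> verts G \<and> v \<in> verts G \<and> u \<noteq> v \<and> {u, v} \<notin> edges G}\<rparr>"

definition walk :: "'a ugraph \<Rightarrow> 'a list \<Rightarrow> bool" where
  "walk G xs \<longleftrightarrow> xs \<noteq> [] \<and> set xs \<subseteq> verts G \<and>
     (\<forall>i. Suc i < length xs \<longrightarrow> {xs ! i, xs ! Suc i} \<in> edges G)"

text \<open>The graph without vertices counts as connected here.\<close>

definition connected_graph :: "'a ugraph \<Rightarrow> bool" where
  "connected_graph G \<longleftrightarrow>
     (\<forall>u\<in>verts G. \<forall>v\<in>verts G. \<exists>xs. walk G xs \<and> hd xs = u \<and> last xs = v)"

definition bipartite :: "'a ugraph \<Rightarrow> bool" where
  "bipartite G \<longleftrightarrow>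
     (\<exists>A B. A \<union> B = verts G \<and> A \<inter> B = {} \<and>
        (\<forall>e\<in>edges G. \<exists>a\<in>A. \<exists>b\<in>B. e = {a, b}))"

text \<open>
  A cycle is given by the list of its vertices in cyclic order, without repeating the first
  vertex at the end, so that its length is the length of the list.
\<close>

definition cycle_edges :: "'a list \<Rightarrow> 'a set set" where
  "cycle_edges xs = {{xs ! i, xs ! (Suc i mod length xs)} |i. i < length xs}"

definition cycle_in :: "'a ugraph \<Rightarrow> 'a list \<Rightarrow> bool" where
  "cycle_in G xs \<longleftrightarrow>
     3 \<le> length xs \<and> distinct xs \<and> set xs \<subseteq> verts G \<and> cycle_edges xs \<subseteq> edges G"

definition chord_of :: "'a ugraph \<Rightarrow> 'a list \<Rightarrow> 'a set \<Rightarrow> bool" where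
  "chord_of G xs e \<longleftrightarrow> e \<in> edges G \<and> e \<subseteq> set xs \<and> e \<notin> cycle_edges xs"

definition chordal_bipartite :: "'a ugraph \<Rightarrow> bool" where
  "chordal_bipartite G \<longleftrightarrow>
     bipartite G \<and> (\<forall>xs. cycle_in G xs \<and> 6 \<le> length xs \<longrightarrow> (\<exists>e. chord_of G xs e))"

definition induced_subgraph :: "'a ugraph \<Rightarrow> 'a set \<Rightarrow> 'a ugraph" where
  "induced_subgraph G W = \<lparr>verts = W, edges = {e \<in> edges G. e \<subseteq> W}\<rparr>"

definition graph_iso :: "'a ugraph \<Rightarrow> 'b ugraph \<Rightarrow> bool" where
  "graph_iso G H \<longleftrightarrow>
     (\<exists>f. bij_betw f (verts G) (verts H) \<and>
        (\<forall>u\<in>verts G. \<forall>v\<in>verts G. {u, v} \<in> edges G \<longleftrightarrow> {f u, f v} \<in> edges H))"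

definition has_induced :: "'a ugraph \<Rightarrow> 'b ugraph \<Rightarrow> bool" where
  "has_induced G H \<longleftrightarrow> (\<exists>W \<subseteq> verts G. graph_iso H (induced_subgraph G W))"

definition path_graph :: "nat \<Rightarrow> nat ugraph" where
  "path_graph n = \<lparr>verts = {..<n}, edges = {{i, Suc i} |i. Suc i < n}\<rparr>"

text \<open>A cycle graph only for \<open>n \<ge> 3\<close>.\<close>

definition cycle_graph :: "nat \<Rightarrow> nat ugraph" where
  "cycle_graph n = \<lparr>verts = {..<n}, edges = {{i, Suc i mod n} |i. i < n}\<rparr>"

definition chordal :: "'a ugraph \<Rightarrow> bool" where
  "chordal G \<longleftrightarrow> (\<forall>k\<ge>4. \<not> has_induced G (cycle_graph k))"

end

(*
  In a connected P5-free bipartite graph, any two edges ab and cd either share a vertex or are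
  joined by an edge. For fixed ab this propagates along walks from a: if it holds for all edges
  at x but fails for an edge x'y with x' a neighbour of x, then x is adjacent to a or b, and
  b, a, x, x', y (or a, b, x, x', y) is an induced P5. An induced 4-cycle of the complement is an
  induced 2K2 of G, an induced 5-cycle of the complement is a 5-cycle of G, and a longer one
  yields the triangle on its vertices 0, 2, 4 in G.
*)

theory Submission
  imports Defs
begin

text \<open>The isomorphism is \<open>nth\<close> of the vertex list, checked on all 25 index pairs.
  \<open>graph_iso\<close> also compares pairs with equal entries, which become singletons; hence
  \<open>loopless\<close>.\<close>

lemma induced_path5I:
  assumes verts: "{a, b, c, d, e} \<subseteq> verts G" and distinct: "distinct [a, b, c, d, e]"
    and edges: "{a, b} \<in> edges G" "{b, c} \<in> edges G" "{c, d} \<in> edges G" "{d, e} \<in> edges G"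
    and non_edges: "{a, c} \<notin> edges G" "{a, d} \<notin> edges G" "{a, e} \<notin> edges G"
      "{b, d} \<notin> edges G" "{b, e} \<notin> edges G" "{c, e} \<notin> edges G"
    and loopless: "\<And>v. {v} \<notin> edges G"
  shows "has_induced G (path_graph 5)"
proof -
  let ?xs = "[a, b, c, d, e]"
  let ?W = "set ?xs"
  have lt5: "i < 5 \<longleftrightarrow> i = 0 \<or> i = 1 \<or> i = 2 \<or> i = 3 \<or> i = 4" for i :: nat
    by auto
  have "bij_betw (nth ?xs) {..<5} ?W"
    using distinct by (intro bij_betw_nth) auto
  moreover have "{i, j} \<in> edges (path_graph 5) \<longleftrightarrow>
      {?xs ! i, ?xs ! j} \<in> edges (induced_subgraph G ?W)" if "i < 5" "j < 5" for i j
  proof -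
    have "{i, j} \<in> edges (path_graph 5) \<longleftrightarrow> j = Suc i \<or> i = Suc j"
      using that by (auto simp: path_graph_def doubleton_eq_iff)
    moreover have "{?xs ! i, ?xs ! j} \<in> edges G \<longleftrightarrow> j = Suc i \<or> i = Suc j"
      using that edges non_edges loopless unfolding lt5
      by (elim disjE) (simp_all add: insert_commute)
    moreover have "?xs ! i \<in> ?W" "?xs ! j \<in> ?W"
      using that by (auto intro!: nth_mem simp del: set_simps)
    ultimately show ?thesis
      by (simp add: induced_subgraph_def)
  qed
  ultimately have "graph_iso (path_graph 5) (induced_subgraph G ?W)"
    unfolding graph_iso_def
    by (intro exI[of _ "nth ?xs"]) (simp add: path_graph_def induced_subgraph_def)
  then show ?thesis
    unfolding has_induced_def using verts by (intro exI[of _ ?W]) simp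
qed

text \<open>One side of the bipartition serves as a proper 2-colouring. Taking \<open>u = v\<close>
  excludes loops, and chaining the equivalence around an odd cycle gives a contradiction.\<close>

lemma bipartite_coloring:
  assumes "bipartite G"
  obtains A where "\<And>u v. {u, v} \<in> edges G \<Longrightarrow> u \<in> A \<longleftrightarrow> v \<notin> A"
proof -
  obtain A B where "A \<inter> B = {}" "\<forall>e\<in>edges G. \<exists>a\<in>A. \<exists>b\<in>B. e = {a, b}"
    using assms unfolding bipartite_def by blast
  then have "u \<in> A \<longleftrightarrow> v \<notin> A" if "{u, v} \<in> edges G" for u v
    using that by (fastforce simp: doubleton_eq_iff)
  then show thesis by (rule that)
qed

lemma walk_invariant:
  assumes "walk G xs" and "P (hd xs)"
    and "\<And>x y. {x, y} \<in> edges G \<Longrightarrow> P x \<Longrightarrow> P y"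
  shows "P (last xs)"
proof -
  have "P (xs ! i)" if "i < length xs" for i
    using that
  proof (induction i)
    case 0
    then show ?case using assms(2) by (simp add: hd_conv_nth)
  next
    case (Suc i)
    then show ?case using assms(1,3) unfolding walk_def by (meson Suc_lessD)
  qed
  then show ?thesis
    using assms(1) by (simp add: walk_def last_conv_nth)
qed

lemma edges_meet_or_joined:
  assumes simple: "simple_graph G" and conn: "connected_graph G" and bip: "bipartite G"
    and P5_free: "\<not> has_induced G (path_graph 5)"
    and ab: "{a, b} \<in> edges G" and cd: "{c, d} \<in> edges G"
  shows "\<exists>u\<in>{c, d}. \<exists>w\<in>{a, b}. u = w \<or> {u, w} \<in> edges G"
proof -
  obtain A where col: "\<And>u v. {u, v} \<in> edges G \<Longrightarrow> u \<in> A \<longleftrightarrow> v \<notin> A"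
    using bipartite_coloring[OF bip] by blast
  have in_verts: "u \<in> verts G" "v \<in> verts G" if "{u, v} \<in> edges G" for u v
    using simple that unfolding simple_graph_def by blast+
  have loopless: "{v} \<notin> edges G" for v
    using col[of v v] by auto
  define near where "near u \<longleftrightarrow> (\<exists>w\<in>{a, b}. u = w \<or> {u, w} \<in> edges G)" for u
  \<comment> \<open>The names \<open>p\<close>, \<open>q\<close> stand for \<open>a\<close>,
    \<open>b\<close> in either order, since \<open>x\<close> may be attached to either end. The
    forbidden path is \<open>q, p, x, x', y\<close>.\<close>
  have step: False
    if pq: "{p, q} \<in> edges G" "{p, q} = {a, b}" and px: "{p, x} \<in> edges G"
      and xx: "{x, x'} \<in> edges G" and xy: "{x', y} \<in> edges G"
      and far: "\<not> near x'" "\<not> near y" for p q x x' y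
  proof -
    have far_pq: "x' \<noteq> p" "x' \<noteq> q" "y \<noteq> p" "y \<noteq> q" "{x', p} \<notin> edges G" "{x', q} \<notin> edges G"
      "{y, p} \<notin> edges G" "{y, q} \<notin> edges G"
      using far unfolding near_def pq(2)[symmetric] by blast+
    \<comment> \<open>Each pair has a common neighbour, \<open>p\<close> and \<open>x'\<close>
      respectively, so its members have the same colour.\<close>
    have "{q, x} \<notin> edges G" "{x, y} \<notin> edges G"
      using col[OF pq(1)] col[OF px] col[OF xx] col[OF xy] col[of q x] col[of x y] by blast+
    \<comment> \<open>If \<open>x = q\<close>, then \<open>x'\<close> would be adjacent to
      \<open>q\<close>; if \<open>x = y\<close>, then \<open>y\<close> would be adjacent to
      \<open>p\<close>. Both contradict \<open>far_pq\<close>.\<close>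
    moreover have "distinct [q, p, x, x', y]"
      using far_pq pq(1) px xx xy loopless
      by (auto simp: insert_commute)
    moreover have "{q, p, x, x', y} \<subseteq> verts G"
      using in_verts[OF pq(1)] in_verts[OF xx] in_verts[OF xy] by blast
    ultimately have "has_induced G (path_graph 5)"
      using far_pq pq(1) px xx xy loopless
      by (intro induced_path5I[of q p x x' y]) (simp_all add: insert_commute)
    then show False using P5_free by blast
  qed
  obtain xs where xs: "walk G xs" "hd xs = a" "last xs = c"
    using conn in_verts[OF ab] in_verts[OF cd] unfolding connected_graph_def by blast
  \<comment> \<open>The invariant covers all edges at the current vertex, so that the induction step
    may apply it to the walk edge from \<open>x\<close> to \<open>x'\<close>. The claim is its
    instance \<open>y = d\<close> at the end of the walk.\<close>
  have "\<forall>y. {last xs, y} \<in> edges G \<longrightarrow> near (last xs) \<or> near y"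
  proof (rule walk_invariant[OF xs(1)])
    show "\<forall>y. {hd xs, y} \<in> edges G \<longrightarrow> near (hd xs) \<or> near y"
      unfolding xs near_def by blast
  next
    fix x x' assume xx: "{x, x'} \<in> edges G"
      and IH: "\<forall>y. {x, y} \<in> edges G \<longrightarrow> near x \<or> near y"
    show "\<forall>y. {x', y} \<in> edges G \<longrightarrow> near x' \<or> near y"
    proof (intro allI impI, rule ccontr)
      fix y assume xy: "{x', y} \<in> edges G" and "\<not> (near x' \<or> near y)"
      then have far: "\<not> near x'" "\<not> near y" by auto
      have "near x" using IH xx far by blast
      \<comment> \<open>Otherwise \<open>x'\<close>, being a neighbour of \<open>x\<close>, would be
        near. So \<open>x\<close> is near only by adjacency.\<close>
      moreover have "x \<noteq> a" "x \<noteq> b"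
        using far xx unfolding near_def by (auto simp: insert_commute)
      ultimately have "{a, x} \<in> edges G \<or> {b, x} \<in> edges G"
        unfolding near_def by (auto simp: insert_commute)
      moreover have "{b, a} \<in> edges G" "{b, a} = {a, b}"
        using ab by (simp_all add: insert_commute)
      ultimately show False
        using step[OF ab refl _ xx xy far] step[OF _ _ _ xx xy far] by blast
    qed
  qed
  then show ?thesis
    using cd unfolding xs near_def by blast
qed

text \<open>Complementing back, G induces on the image of \<open>f\<close> the complement of the
  k-cycle. The complement never has loops while G is arbitrary here, so the conjunct
  \<open>f i \<noteq> f j\<close> keeps the equivalence true at \<open>i = j\<close>.\<close>

lemma induced_cycle_complementE:
  assumes "has_induced (graph_complement G) (cycle_graph k)"
  obtains f where
    "\<And>i j. i < k \<Longrightarrow> j < k \<Longrightarrow>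
      {f i, f j} \<in> edges G \<and> f i \<noteq> f j \<longleftrightarrow> i \<noteq> j \<and> j \<noteq> Suc i mod k \<and> i \<noteq> Suc j mod k"
    and "inj_on f {..<k}"
proof -
  obtain W f where W: "W \<subseteq> verts G" and bij: "bij_betw f {..<k} W"
    and iso: "\<And>i j. i < k \<Longrightarrow> j < k \<Longrightarrow> {i, j} \<in> edges (cycle_graph k) \<longleftrightarrow>
      {f i, f j} \<in> edges (induced_subgraph (graph_complement G) W)"
    using assms unfolding has_induced_def graph_iso_def
    by (auto simp: cycle_graph_def induced_subgraph_def graph_complement_def)
  have inj: "inj_on f {..<k}" using bij by (simp add: bij_betw_def)
  have "{f i, f j} \<in> edges G \<and> f i \<noteq> f j \<longleftrightarrow> i \<noteq> j \<and> j \<noteq> Suc i mod k \<and> i \<noteq> Suc j mod k"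
    if "i < k" "j < k" for i j
  proof -
    have mem: "f i \<in> W" "f j \<in> W" using bij that by (auto simp: bij_betw_def)
    have "{i, j} \<in> edges (cycle_graph k) \<longleftrightarrow> j = Suc i mod k \<or> i = Suc j mod k"
      using that by (auto simp: cycle_graph_def doubleton_eq_iff)
    moreover have "{f i, f j} \<in> edges (induced_subgraph (graph_complement G) W) \<longleftrightarrow>
        f i \<noteq> f j \<and> {f i, f j} \<notin> edges G"
      using mem W
      by (auto simp: induced_subgraph_def graph_complement_def doubleton_eq_iff insert_commute)
    moreover have "f i = f j \<longleftrightarrow> i = j"
      using inj that by (auto simp: inj_on_def)
    ultimately show ?thesis using iso[OF that] by blast
  qed
  then show thesis using inj by (rule that)
qed

theorem theorem16:
  fixes G :: "'a ugraph"
  assumes "simple_graph G"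
    and "connected_graph G"
    and "\<not> has_induced G (path_graph 5)"
    and "chordal_bipartite G"
  shows "chordal (graph_complement G)"
  unfolding chordal_def
proof (intro allI impI notI)
  fix k :: nat
  assume k: "4 \<le> k" and "has_induced (graph_complement G) (cycle_graph k)"
  then obtain f where adj: "\<And>i j. i < k \<Longrightarrow> j < k \<Longrightarrow>
      {f i, f j} \<in> edges G \<and> f i \<noteq> f j \<longleftrightarrow> i \<noteq> j \<and> j \<noteq> Suc i mod k \<and> i \<noteq> Suc j mod k"
    and inj: "inj_on f {..<k}"
    using induced_cycle_complementE by blast
  have bip: "bipartite G" using assms(4) by (simp add: chordal_bipartite_def)
  obtain A where col: "\<And>u v. {u, v} \<in> edges G \<Longrightarrow> u \<in> A \<longleftrightarrow> v \<notin> A"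
    using bipartite_coloring[OF bip] by blast
  consider "k = 4" | "k = 5" | "k \<ge> 6" using k by linarith
  then show False
  proof cases
    case 1
    have "{f 0, f 2} \<in> edges G" "{f 1, f 3} \<in> edges G"
      using adj[of 0 2] adj[of 1 3] 1 by auto
    then have "\<exists>u\<in>{f 1, f 3}. \<exists>w\<in>{f 0, f 2}. u = w \<or> {u, w} \<in> edges G"
      using edges_meet_or_joined[OF assms(1,2) bip assms(3)] by blast
    \<comment> \<open>The two diagonals share no vertex. The four pairs between them are consecutive
      modulo 4, with 3 followed by 0, so none is an edge of G.\<close>
    moreover have "f 1 \<noteq> f 0" "f 1 \<noteq> f 2" "f 3 \<noteq> f 0" "f 3 \<noteq> f 2"
      using 1 by (simp_all add: inj_on_eq_iff[OF inj])
    ultimately show False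
      using adj[of 1 0] adj[of 1 2] adj[of 3 0] adj[of 3 2] 1 by auto
  next
    case 2
    \<comment> \<open>Steps of two modulo 5 traverse the complementary pentagon, an odd
      cycle.\<close>
    have "{f 0, f 2} \<in> edges G" "{f 2, f 4} \<in> edges G" "{f 4, f 1} \<in> edges G"
      "{f 1, f 3} \<in> edges G" "{f 3, f 0} \<in> edges G"
      using adj[of 0 2] adj[of 2 4] adj[of 4 1] adj[of 1 3] adj[of 3 0] 2 by auto
    then show False using col by blast
  next
    case 3
    \<comment> \<open>The indices 4 and 0 are non-consecutive because \<open>k \<ge> 6\<close>;
      modulo 5 they would be neighbours.\<close>
    have "{f 0, f 2} \<in> edges G" "{f 2, f 4} \<in> edges G" "{f 4, f 0} \<in> edges G"
      using adj[of 0 2] adj[of 2 4] adj[of 4 0] 3 by auto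
    then show False using col by blast
  qed
qed

end
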